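(* Let $S_0$ be an $n\times n$ real symmetric matrix with positive simple spectrum (its eigenvalues are positive and distinct), and let $(S_m)_{m\ge 0}$ be the $QR$ sequence starting from $S_0$. The flow associated to the differential equation $$\dot S(t) = [\,S(t),\ \Pi_{sk}(\ln S(t))\,], \qquad S(0)=S_0,$$ interpolates the $QR$ sequence; that is, $S(m)=S_m$ for every integer $m\ge 0$.
   Context: $[A,B]=AB-BA$. For a real $n\times n$ matrix $M$, $\Pi_{sk}M$ denotes the skew-symmetric matrix having the same strictly lower triangular part as $M$. For a real symmetric matrix $S$ with positive eigenvalues, $\ln S$ is defined by the spectral functional calculus. $SO(n)$ is the group of real orthogonal $n\times n$ matrices of determinant $1$, and $\mathcal{U}^+(n)$ is the group of real upper triangular $n\times n$ matrices with positive diagonal entries. Every real matrix $X$ with $\det X>0$ has a unique factorization $X=QR$ with $Q\in SO(n)$ and $R\in\mathcal{U}^+(n)$, called its $QR$ factorization. The $QR$ sequence starting from $S_0$ is defined recursively: given $S_m$, take its $QR$ factorization $S_m=Q_mR_m$ and set $S_{m+1}=R_mQ_m$ (equivalently $S_{m+1}=Q_m^TS_mQ_m=R_mS_mR_m^{-1}$). *)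

theory Defs
  imports "HOL-Analysis.Analysis"
begin

text \<open>
  Square matrices \<open>real^'n^'n\<close>; the notation with \<open>^\<close> is avoided here because it fixes the sort of
  \<open>'n\<close> to be exactly \<open>finite\<close>.  Where \<open>'n\<close> also carries a linear order, the order identifies it
  with \<open>{1..n}\<close> and gives meaning to ``upper'' and ``lower'' triangular.
\<close>

type_synonym 'n sqmat = "((real, 'n) vec, 'n) vec"

definition mat_commutator :: "'n::finite sqmat \<Rightarrow> 'n sqmat \<Rightarrow> 'n sqmat" where
  "mat_commutator A B = A ** B - B ** A"

definition symmetric_matrix :: "'n::finite sqmat \<Rightarrow> bool" where
  "symmetric_matrix S \<longleftrightarrow> transpose S = S"

definition upper_triangular :: "'n::{finite,linorder} sqmat \<Rightarrow> bool" where
  "upper_triangular R \<longleftrightarrow> (\<forall>i j. j < i \<longrightarrow> R $ i $ j = 0)"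

definition skew_part :: "'n::{finite,linorder} sqmat \<Rightarrow> 'n sqmat" where
  "skew_part M = (\<chi> i j. if j < i then M $ i $ j else if i < j then - M $ j $ i else 0)"

definition diag_matrix :: "real^'n \<Rightarrow> 'n::finite sqmat" where
  "diag_matrix d = (\<chi> i j. if i = j then d $ i else 0)"

text \<open>Real eigenvalues only; below these predicates are applied to symmetric matrices, which have no others.\<close>

definition eigenvalues :: "'n::finite sqmat \<Rightarrow> real set" where
  "eigenvalues S = {c. \<exists>v. v \<noteq> 0 \<and> S *v v = c *s v}"

definition positive_spectrum :: "'n::finite sqmat \<Rightarrow> bool" where
  "positive_spectrum S \<longleftrightarrow> (\<forall>c\<in>eigenvalues S. 0 < c)"

definition simple_spectrum :: "'n::finite sqmat \<Rightarrow> bool" where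
  "simple_spectrum S \<longleftrightarrow> card (eigenvalues S) = CARD('n)"

text \<open>
  For symmetric \<open>S\<close> an orthogonal diagonalization exists, and the matrix \<open>T\<close> below does not
  depend on which one is chosen.  For other \<open>S\<close> the value is unspecified.
\<close>

definition spectral_calculus :: "(real \<Rightarrow> real) \<Rightarrow> 'n::finite sqmat \<Rightarrow> 'n sqmat" where
  "spectral_calculus f S =
     (THE T. \<exists>U d. orthogonal_matrix U \<and>
        S = U ** diag_matrix d ** transpose U \<and>
        T = U ** diag_matrix (\<chi> i. f (d $ i)) ** transpose U)"

definition matrix_ln :: "'n::finite sqmat \<Rightarrow> 'n sqmat" where
  "matrix_ln S = spectral_calculus ln S"

definition pos_upper_triangular :: "'n::{finite,linorder} sqmat \<Rightarrow> bool" where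
  "pos_upper_triangular R \<longleftrightarrow> upper_triangular R \<and> (\<forall>i. 0 < R $ i $ i)"

text \<open>Meaningful when \<open>0 < det X\<close>, in which case the pair exists and is unique.\<close>

definition qr_factorization ::
  "'n::{finite,linorder} sqmat \<Rightarrow> 'n sqmat \<times> 'n sqmat" where
  "qr_factorization X =
     (THE (Q, R). rotation_matrix Q \<and> pos_upper_triangular R \<and> X = Q ** R)"

primrec qr_sequence :: "'n::{finite,linorder} sqmat \<Rightarrow> nat \<Rightarrow> 'n sqmat" where
  "qr_sequence S0 0 = S0"
| "qr_sequence S0 (Suc m) = (let (Q, R) = qr_factorization (qr_sequence S0 m) in R ** Q)"

text \<open>
  Solutions of the differential equation on a time interval \<open>I\<close>, with one-sided derivatives at
  endpoints belonging to \<open>I\<close>.  The vector field involves the logarithm, so it is defined only on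
  symmetric matrices with positive eigenvalues; a solution has to take its values there.
\<close>

definition qr_flow_solution ::
  "real set \<Rightarrow> 'n::{finite,linorder} sqmat \<Rightarrow> (real \<Rightarrow> 'n sqmat) \<Rightarrow> bool" where
  "qr_flow_solution I S0 S \<longleftrightarrow>
     S 0 = S0 \<and>
     (\<forall>t\<in>I. symmetric_matrix (S t) \<and> positive_spectrum (S t) \<and>
        (S has_vector_derivative mat_commutator (S t) (skew_part (matrix_ln (S t))))
          (at t within I))"

end

theory Submission
  imports Defs
begin

text \<open>
  Put \<open>L = ln S0\<close> and factor \<open>e\<^sup>t\<^sup>L = Q(t) R(t)\<close>, where \<open>Q\<close> and \<open>R\<close> are differentiable because the
  Gram-Schmidt process is.  Differentiating this identity shows that \<open>Q\<^sup>T Q'\<close> is the skew part of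
  \<open>Q\<^sup>T L Q = ln (Q\<^sup>T S0 Q)\<close>, so \<open>S = Q\<^sup>T S0 Q\<close> solves the differential equation, and
  \<open>e\<^bsup>(m+1)L\<^esup> = S0 e\<^bsup>mL\<^esup>\<close> yields the QR factorization \<open>S(m) = (Q(m)\<^sup>T Q(m+1)) (R(m+1) R(m)\<inverse>)\<close>.

  For uniqueness, a polynomial \<open>p\<close> and a solution \<open>T\<close> satisfy \<open>p(T)' = [p(T), A]\<close> with \<open>p(T)\<close> symmetric
  and \<open>A\<close> skew, hence \<open>p(T)\<close> has constant Frobenius norm.  So the spectrum of \<open>T\<close> is constant, and on the
  matrices with that spectrum the logarithm is a fixed (Lagrange) polynomial.  The equation thus
  becomes one with a locally Lipschitz right-hand side along bounded solutions.
\<close>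

subsection \<open>Matrix algebra\<close>

lemma matrix_diff_left_distrib: "A ** (B - C) = A ** B - A ** C"
  for A B C :: "'n::finite sqmat"
  by (simp add: matrix_matrix_mult_def vec_eq_iff algebra_simps sum_subtractf)

lemma matrix_diff_right_distrib: "(A - B) ** C = A ** C - B ** C"
  for A B C :: "'n::finite sqmat"
  by (simp add: matrix_matrix_mult_def vec_eq_iff algebra_simps sum_subtractf)

lemma matrix_add_right_distrib: "(A + B) ** C = A ** C + B ** C"
  for A B C :: "'n::finite sqmat"
  by (simp add: matrix_matrix_mult_def vec_eq_iff algebra_simps sum.distrib)

lemma matrix_minus_left: "(- A) ** B = - (A ** B)"
  for A B :: "'n::finite sqmat"
  by (simp add: matrix_matrix_mult_def vec_eq_iff sum_negf)

lemma matrix_minus_right: "A ** (- B) = - (A ** B)"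
  for A B :: "'n::finite sqmat"
  by (simp add: matrix_matrix_mult_def vec_eq_iff sum_negf)

text \<open>Source of the product rule for derivatives and of the Lipschitz estimate for matrix
  products.\<close>

lemma bounded_bilinear_matrix_mult:
  "bounded_bilinear ((**) :: 'n::finite sqmat \<Rightarrow> 'n sqmat \<Rightarrow> 'n sqmat)"
  unfolding bilinear_conv_bounded_bilinear[symmetric] bilinear_def
  by (auto intro!: linearI simp: matrix_add_ldistrib matrix_add_right_distrib matrix_scalar_ac
      scalar_matrix_assoc)

lemma bounded_linear_transpose: "bounded_linear (transpose :: 'n::finite sqmat \<Rightarrow> 'n sqmat)"
  unfolding linear_conv_bounded_linear[symmetric]
  by (auto intro!: linearI simp: transpose_def vec_eq_iff)

lemma bounded_linear_skew_part:
  "bounded_linear (skew_part :: 'n::{finite,linorder} sqmat \<Rightarrow> 'n sqmat)"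
  unfolding linear_conv_bounded_linear[symmetric]
  by (auto intro!: linearI simp: skew_part_def vec_eq_iff)

lemma transpose_skew_part: "transpose (skew_part M) = - skew_part M"
  by (auto simp: skew_part_def transpose_def vec_eq_iff)

text \<open>The inherited inner product is the Frobenius one, tr(X^T Y); reordering the triple sum
  of entries shows that right multiplication by \<open>Z\<close> has right multiplication by
  \<open>transpose Z\<close> as its adjoint.\<close>

lemma inner_matrix_mult_right: "inner X (Y ** Z) = inner (X ** transpose Z) Y"
  for X Y Z :: "'n::finite sqmat"
proof -
  have "inner X (Y ** Z) = (\<Sum>i\<in>UNIV. \<Sum>j\<in>UNIV. \<Sum>k\<in>UNIV. X$i$j * (Y$i$k * Z$k$j))"
    by (simp add: inner_vec_def matrix_matrix_mult_def sum_distrib_left)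
  also have "\<dots> = (\<Sum>i\<in>UNIV. \<Sum>k\<in>UNIV. \<Sum>j\<in>UNIV. X$i$j * (Y$i$k * Z$k$j))"
    by (intro sum.cong[OF refl] sum.swap)
  also have "\<dots> = inner (X ** transpose Z) Y"
    by (simp add: inner_vec_def matrix_matrix_mult_def transpose_def sum_distrib_left
        sum_distrib_right mult.assoc mult.left_commute mult.commute)
  finally show ?thesis .
qed

lemma inner_transpose: "inner (transpose X) (transpose Y) = inner X Y"
  for X Y :: "'n::finite sqmat"
  unfolding inner_vec_def transpose_def vec_lambda_beta by (rule sum.swap)

text \<open>Moving \<open>A\<close> across the inner product shows that
  \<open>inner M (M ** A)\<close> equals its own negative, and transposition reduces the other term
  to this one. This is the infinitesimal form of the invariance of the Frobenius norm under
  orthogonal conjugation.\<close>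

lemma inner_commutator_skew:
  fixes M A :: "'n::finite sqmat"
  assumes "transpose M = M" "transpose A = - A"
  shows "inner M (mat_commutator M A) = 0"
proof -
  have "inner M (M ** A) = - inner (M ** A) M"
    using inner_matrix_mult_right[of M M A] assms by (simp add: matrix_minus_right)
  then have 1: "inner M (M ** A) = 0"
    by (simp add: inner_commute)
  have "inner M (A ** M) = inner (transpose M) (transpose (A ** M))"
    by (simp add: inner_transpose)
  also have "\<dots> = - inner M (M ** A)"
    by (simp add: matrix_transpose_mul assms matrix_minus_right)
  finally show ?thesis
    using 1 by (simp add: mat_commutator_def inner_diff_right)
qed

section \<open>Products with diagonal and orthogonal matrices\<close>

lemma mult_diag_matrix_component: "(A ** diag_matrix d) $ i $ j = A$i$j * d$j"
  by (simp add: diag_matrix_def matrix_matrix_mult_def mult_delta_right)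

lemma diag_matrix_mult_component: "(diag_matrix d ** A) $ i $ j = d$i * A$i$j"
  by (simp add: diag_matrix_def matrix_matrix_mult_def mult_delta_left)

lemma diag_matrix_mult_vector_component: "(diag_matrix d *v v) $ i = d$i * v$i"
  by (simp add: diag_matrix_def matrix_vector_mult_def mult_delta_left)

lemma diag_matrix_mult: "diag_matrix d ** diag_matrix e = diag_matrix (\<chi> i. d$i * e$i)"
  by (auto simp: vec_eq_iff diag_matrix_mult_component) (auto simp: diag_matrix_def)

lemma transpose_diag_matrix: "transpose (diag_matrix d) = diag_matrix d"
  by (auto simp: diag_matrix_def transpose_def vec_eq_iff)

lemma orthogonal_matrix_transpose_mult:
  fixes Q :: "'n::finite sqmat"
  assumes "orthogonal_matrix Q"
  shows "transpose Q ** Q = mat 1" "Q ** transpose Q = mat 1"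
    "transpose Q ** (Q ** X) = X" "Q ** (transpose Q ** X) = X"
  using assms by (auto simp: orthogonal_matrix_def matrix_mul_assoc)

subsection \<open>Triangular matrices\<close>

text \<open>The number of elements below \<open>j\<close> is the measure of the recursion. Among
  other things this serves to treat the columns of a triangular matrix from left to right.\<close>

lemma linorder_finite_induct:
  fixes P :: "'n::{finite,linorder} \<Rightarrow> bool"
  assumes "\<And>j. (\<And>k. k < j \<Longrightarrow> P k) \<Longrightarrow> P j"
  shows "P j"
proof (induction j rule: measure_induct_rule[where f = "\<lambda>j. card {..<j}"])
  case (less j)
  show ?case
  proof (rule assms)
    fix k assume "k < j"
    then show "P k" by (intro less psubset_card_mono) auto
  qed
qed

text \<open>As \<open>det_upperdiagonal\<close>, whose index type has to be of class \<open>wellorder\<close>.\<close>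

lemma det_upper_triangular:
  fixes R :: "'n::{finite,linorder} sqmat"
  assumes "upper_triangular R"
  shows "det R = (\<Prod>i\<in>UNIV. R$i$i)"
proof -
  \<comment> \<open>Such a \<open>p\<close> contributes a zero entry of \<open>R\<close> to its
    Leibniz term, so only the identity survives in the determinant.\<close>
  have below_diagonal: "\<exists>i. p i < i" if p: "p permutes UNIV" "p \<noteq> id" for p :: "'n \<Rightarrow> 'n"
  proof (rule ccontr)
    assume "\<not> (\<exists>i. p i < i)"
    then have le: "i \<le> p i" for i by (simp add: not_less)
    \<comment> \<open>If \<open>inv p j < j\<close>, the induction hypothesis makes
      \<open>inv p j\<close> a fixed point, so \<open>p\<close> would send it to itself and not to
      \<open>j\<close>.\<close>
    have "inv p j = j" for j
    proof (induction j rule: linorder_finite_induct)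
      case (1 j)
      have pj: "p (inv p j) = j" using permutes_inverses(1)[OF p(1)] .
      show ?case
      proof (rule ccontr)
        assume "inv p j \<noteq> j"
        moreover have "inv p j \<le> j" using le[of "inv p j"] pj by simp
        ultimately have "inv p (inv p j) = inv p j" by (intro 1) simp
        then have "p (inv p (inv p j)) = j" using pj by simp
        then show False
          using permutes_inverses(1)[OF p(1), of "inv p j"] \<open>inv p j \<noteq> j\<close> by simp
      qed
    qed
    then have "p j = j" for j
      using permutes_inverses(1)[OF p(1), of j] by simp
    then show False using p(2) by (simp add: fun_eq_iff)
  qed
  have "of_int (sign p) * (\<Prod>i\<in>UNIV. R$i$p i) = 0" if p: "p permutes UNIV" "p \<noteq> id" for p :: "'n \<Rightarrow> 'n"
  proof -
    obtain i where "p i < i" using below_diagonal[OF p] ..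
    then have "R$i$p i = 0" using assms by (simp add: upper_triangular_def)
    then have "(\<Prod>i\<in>UNIV. R$i$p i) = 0" by (intro prod_zero) auto
    then show ?thesis by simp
  qed
  then have "det R = (\<Sum>p\<in>{id}. of_int (sign p) * (\<Prod>i\<in>UNIV. R$i$p i))"
    unfolding det_def by (intro sum.mono_neutral_right) (auto simp: permutes_id)
  then show ?thesis by (simp add: sign_id)
qed

lemma upper_triangular_mult_diagonal:
  fixes R :: "'n::{finite,linorder} sqmat"
  assumes "upper_triangular N" "upper_triangular R"
  shows "(N ** R) $ j $ j = N$j$j * R$j$j"
proof -
  have "(N ** R) $ j $ j = (\<Sum>k\<in>UNIV. if k = j then N$j$j * R$j$j else 0)"
    unfolding matrix_matrix_mult_def vec_lambda_beta
  proof (rule sum.cong[OF refl])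
    fix k
    show "N$j$k * R$k$j = (if k = j then N$j$j * R$j$j else 0)"
      using assms by (cases k j rule: linorder_cases) (simp_all add: upper_triangular_def)
  qed
  then show ?thesis by simp
qed

text \<open>Below the diagonal, entry (i,j) of the product reduces to \<open>N$i$j * R$j$j\<close>:
  earlier columns of \<open>N\<close> vanish in row i by induction, and \<open>R\<close> vanishes
  below its diagonal. This avoids inverting \<open>R\<close>.\<close>

lemma upper_triangular_cancel:
  fixes R :: "'n::{finite,linorder} sqmat"
  assumes R: "pos_upper_triangular R" and NR: "upper_triangular (N ** R)"
  shows "upper_triangular N"
proof -
  have "\<forall>i. j < i \<longrightarrow> N$i$j = 0" for j
  proof (induction j rule: linorder_finite_induct)
    case (1 j)
    show ?case
    proof (intro allI impI)
      fix i assume ij: "j < i"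
      have "N$i$k * R$k$j = (if k = j then N$i$j * R$j$j else 0)" for k
      proof (cases k j rule: linorder_cases)
        case less
        then show ?thesis using 1[of k] ij by simp
      next
        case greater
        then show ?thesis using R by (simp add: pos_upper_triangular_def upper_triangular_def)
      qed simp
      then have "(N ** R) $ i $ j = (\<Sum>k\<in>UNIV. if k = j then N$i$j * R$j$j else 0)"
        unfolding matrix_matrix_mult_def vec_lambda_beta by (rule sum.cong[OF refl])
      then have "N$i$j * R$j$j = 0"
        using NR ij by (simp add: upper_triangular_def)
      then show "N$i$j = 0"
        using R by (auto simp: pos_upper_triangular_def dest: spec[of _ j])
    qed
  qed
  then show ?thesis by (auto simp: upper_triangular_def)
qed

lemma pos_upper_triangular_cancel:
  fixes R :: "'n::{finite,linorder} sqmat"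
  assumes R: "pos_upper_triangular R" and NR: "pos_upper_triangular (N ** R)"
  shows "pos_upper_triangular N"
proof -
  have N: "upper_triangular N"
    using upper_triangular_cancel[OF R] NR by (auto simp: pos_upper_triangular_def)
  have "0 < N$j$j" for j
  proof (rule zero_less_mult_pos2)
    show "0 < R$j$j" using R by (simp add: pos_upper_triangular_def)
    have "0 < (N ** R) $ j $ j" using NR by (simp add: pos_upper_triangular_def)
    then show "0 < N$j$j * R$j$j"
      using upper_triangular_mult_diagonal[OF N, of R j] R by (simp add: pos_upper_triangular_def)
  qed
  then show ?thesis using N by (auto simp: pos_upper_triangular_def)
qed

text \<open>Cancelling \<open>N\<close> in \<open>transpose N ** N = mat 1\<close> makes
  \<open>transpose N\<close> upper triangular too. So \<open>N\<close> is diagonal, with positive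
  entries of square 1.\<close>

lemma orthogonal_pos_upper_triangular:
  fixes N :: "'n::{finite,linorder} sqmat"
  assumes O: "orthogonal_matrix N" and N: "pos_upper_triangular N"
  shows "N = mat 1"
proof -
  have NT: "transpose N ** N = mat 1" using O by (simp add: orthogonal_matrix_def)
  have up: "N$i$j = 0" if "j < i" for i j
    using N that by (auto simp: pos_upper_triangular_def upper_triangular_def)
  have "transpose N ** N = mat 1 \<Longrightarrow> pos_upper_triangular (transpose N)"
    by (rule pos_upper_triangular_cancel[OF N])
      (simp add: pos_upper_triangular_def upper_triangular_def mat_def)
  then have lo: "N$i$j = 0" if "i < j" for i j
    using NT that by (auto simp: pos_upper_triangular_def upper_triangular_def transpose_def)
  have "N$i$j = mat 1 $ i $ j" for i j
  proof (cases "i = j")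
    case True
    have "N$k$i * N$k$i = (if k = i then N$i$i * N$i$i else 0)" for k
      using up lo by (cases k i rule: linorder_cases) auto
    then have "(transpose N ** N) $ i $ i = (\<Sum>k\<in>UNIV. if k = i then N$i$i * N$i$i else 0)"
      unfolding matrix_matrix_mult_def transpose_def vec_lambda_beta by (rule sum.cong[OF refl])
    then have "N$i$i * N$i$i = 1" using NT by (simp add: mat_def)
    moreover have "0 < N$i$i" using N by (simp add: pos_upper_triangular_def)
    ultimately show ?thesis using True by (simp add: mat_def square_eq_1_iff)
  next
    case False
    then show ?thesis using up lo by (cases i j rule: linorder_cases) (auto simp: mat_def)
  qed
  then show ?thesis by (simp add: vec_eq_iff)
qed

text \<open>The orthogonal matrix \<open>transpose Q2 ** Q1\<close> carries \<open>R1\<close> to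
  \<open>R2\<close>, hence is also triangular with positive diagonal, hence is the identity.\<close>

lemma qr_unique:
  fixes Q1 Q2 R1 R2 :: "'n::{finite,linorder} sqmat"
  assumes "orthogonal_matrix Q1" "orthogonal_matrix Q2"
    and R: "pos_upper_triangular R1" "pos_upper_triangular R2"
    and eq: "Q1 ** R1 = Q2 ** R2"
  shows "Q1 = Q2" "R1 = R2"
proof -
  let ?N = "transpose Q2 ** Q1"
  have "?N ** R1 = R2"
    using eq assms(2) by (simp add: orthogonal_matrix_transpose_mult flip: matrix_mul_assoc)
  then have "pos_upper_triangular ?N" using pos_upper_triangular_cancel[OF R(1)] R(2) by simp
  then have N: "?N = mat 1"
    using assms by (intro orthogonal_pos_upper_triangular orthogonal_matrix_mul)
      (simp_all only: orthogonal_matrix_transpose)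
  then show "R1 = R2" using \<open>?N ** R1 = R2\<close> by simp
  have "Q1 = Q2 ** ?N" using assms(2) by (simp add: orthogonal_matrix_transpose_mult)
  then show "Q1 = Q2" using N by simp
qed

lemma qr_factorization_eqI:
  fixes Q R :: "'n::{finite,linorder} sqmat"
  assumes "rotation_matrix Q" "pos_upper_triangular R" "X = Q ** R"
  shows "qr_factorization X = (Q, R)"
  unfolding qr_factorization_def
proof (rule the_equality)
  show "case (Q, R) of (Q, R) \<Rightarrow> rotation_matrix Q \<and> pos_upper_triangular R \<and> X = Q ** R"
    using assms by simp
next
  fix z assume "case z of (Q, R) \<Rightarrow> rotation_matrix Q \<and> pos_upper_triangular R \<and> X = Q ** R"
  moreover obtain Q' R' where z: "z = (Q', R')" by (cases z)
  ultimately have *: "orthogonal_matrix Q'" "pos_upper_triangular R'" "Q' ** R' = Q ** R"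
    using assms(3) by (simp_all add: rotation_matrix_def)
  have "orthogonal_matrix Q" using assms(1) by (simp add: rotation_matrix_def)
  then show "z = (Q, R)"
    using qr_unique[OF *(1) _ *(2) assms(2) *(3)] z by simp
qed

subsection \<open>Diagonalization and the spectral calculus\<close>

lemma symmetric_matrix_conj_diag:
  "symmetric_matrix (U ** diag_matrix d ** transpose U)"
  by (simp add: symmetric_matrix_def matrix_transpose_mul transpose_diag_matrix matrix_mul_assoc)

lemma conj_diag_mult:
  assumes "orthogonal_matrix U"
  shows "(U ** diag_matrix d ** transpose U) ** (U ** diag_matrix e ** transpose U)
    = U ** diag_matrix (\<chi> i. d$i * e$i) ** transpose U"
proof -
  have "(U ** diag_matrix d ** transpose U) ** (U ** diag_matrix e ** transpose U)
    = U ** diag_matrix d ** (transpose U ** U) ** diag_matrix e ** transpose U"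
    by (simp add: matrix_mul_assoc)
  also have "\<dots> = U ** (diag_matrix d ** diag_matrix e) ** transpose U"
    using assms by (simp add: orthogonal_matrix_def matrix_mul_assoc)
  finally show ?thesis by (simp add: diag_matrix_mult)
qed

text \<open>In the coordinates w = U^T v the eigenvalue equation reads d_i w_i = c w_i; conversely
  the columns of \<open>U\<close> are eigenvectors.\<close>

lemma eigenvalues_conj_diag:
  fixes U :: "'n::finite sqmat"
  assumes U: "orthogonal_matrix U"
  shows "eigenvalues (U ** diag_matrix d ** transpose U) = range (\<lambda>i. d$i)"
proof (intro equalityI subsetI)
  fix c assume "c \<in> eigenvalues (U ** diag_matrix d ** transpose U)"
  then obtain v where v: "v \<noteq> 0" "(U ** diag_matrix d ** transpose U) *v v = c *s v"
    by (auto simp: eigenvalues_def)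
  define w where "w = transpose U *v v"
  have Uw: "U *v w = v"
    using U by (simp add: w_def matrix_vector_mul_assoc orthogonal_matrix_def
        del: transpose_matrix_vector)
  have "diag_matrix d *v w = transpose U *v (U *v (diag_matrix d *v w))"
    using U by (simp add: matrix_vector_mul_assoc matrix_mul_assoc orthogonal_matrix_transpose_mult)
  also have "\<dots> = transpose U *v (c *s v)"
    using v(2) unfolding w_def by (simp only: matrix_vector_mul_assoc matrix_mul_assoc)
  also have "\<dots> = c *s w" by (simp add: w_def vector_scalar_commute)
  finally have eq: "d$i * w$i = c * w$i" for i
    by (metis diag_matrix_mult_vector_component vector_smult_component)
  have "w \<noteq> 0" using Uw v(1) by auto
  then obtain i where "w$i \<noteq> 0" by (auto simp: vec_eq_iff)
  then show "c \<in> range (\<lambda>i. d$i)" using eq[of i] by auto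
next
  fix c assume "c \<in> range (\<lambda>i. d$i)"
  then obtain i where c: "c = d$i" by auto
  let ?v = "U *v axis i 1"
  have "transpose U *v ?v = axis i 1"
    using U by (simp add: matrix_vector_mul_assoc orthogonal_matrix_def)
  then have "?v \<noteq> 0" by (metis axis_eq_0_iff matrix_vector_mult_0_right zero_neq_one)
  moreover have "diag_matrix d *v axis i 1 = c *s axis i 1"
    by (auto simp: vec_eq_iff diag_matrix_mult_vector_component c axis_def)
  then have "(U ** diag_matrix d ** transpose U) *v ?v = c *s ?v"
    using \<open>transpose U *v ?v = axis i 1\<close>
    by (simp add: vector_scalar_commute flip: matrix_vector_mul_assoc)
  ultimately show "c \<in> eigenvalues (U ** diag_matrix d ** transpose U)"
    by (auto simp: eigenvalues_def)
qed

text \<open>Independence of the diagonalization: W = V^T U intertwines the diagonal matrices of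
  \<open>d\<close> and \<open>e\<close>, so a nonzero entry of \<open>W\<close> at (i,j) forces d_j
  = e_i. Therefore \<open>W\<close> intertwines their images under \<open>f\<close> as well.\<close>

lemma spectral_calculus_conj_diag:
  fixes U :: "'n::finite sqmat"
  assumes U: "orthogonal_matrix U"
  shows "spectral_calculus f (U ** diag_matrix d ** transpose U)
    = U ** diag_matrix (\<chi> i. f (d$i)) ** transpose U"
  unfolding spectral_calculus_def
proof (rule the_equality)
  show "\<exists>U' d'. orthogonal_matrix U' \<and>
      U ** diag_matrix d ** transpose U = U' ** diag_matrix d' ** transpose U' \<and>
      U ** diag_matrix (\<chi> i. f (d$i)) ** transpose U
        = U' ** diag_matrix (\<chi> i. f (d'$i)) ** transpose U'"
    using U by blast
next
  fix T
  assume "\<exists>V e. orthogonal_matrix V \<and>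
      U ** diag_matrix d ** transpose U = V ** diag_matrix e ** transpose V \<and>
      T = V ** diag_matrix (\<chi> i. f (e$i)) ** transpose V"
  then obtain V e where V: "orthogonal_matrix V"
    and eq: "U ** diag_matrix d ** transpose U = V ** diag_matrix e ** transpose V"
    and T: "T = V ** diag_matrix (\<chi> i. f (e$i)) ** transpose V" by blast
  define W where "W = transpose V ** U"
  have "transpose V ** (U ** diag_matrix d ** transpose U) ** U = W ** diag_matrix d"
    using U by (simp add: W_def orthogonal_matrix_def flip: matrix_mul_assoc)
  moreover have "transpose V ** (V ** diag_matrix e ** transpose V) ** U = diag_matrix e ** W"
    using V by (simp add: W_def orthogonal_matrix_transpose_mult flip: matrix_mul_assoc)
  ultimately have "W ** diag_matrix d = diag_matrix e ** W" using eq by metis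
  then have "W$i$j * d$j = e$i * W$i$j" for i j
    by (metis mult_diag_matrix_component diag_matrix_mult_component)
  then have "W$i$j = 0 \<or> d$j = e$i" for i j
    by (simp add: mult.commute)
  then have "W$i$j * f (d$j) = f (e$i) * W$i$j" for i j
    by (metis mult.commute mult_zero_left)
  then have WW: "W ** diag_matrix (\<chi> i. f (d$i)) = diag_matrix (\<chi> i. f (e$i)) ** W"
    by (simp add: vec_eq_iff mult_diag_matrix_component diag_matrix_mult_component)
  have "T = V ** (diag_matrix (\<chi> i. f (e$i)) ** W) ** transpose U"
    using U by (simp add: T W_def orthogonal_matrix_transpose_mult flip: matrix_mul_assoc)
  also have "\<dots> = V ** transpose V ** U ** diag_matrix (\<chi> i. f (d$i)) ** transpose U"
    unfolding WW[symmetric] by (simp add: W_def matrix_mul_assoc)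
  finally show "T = U ** diag_matrix (\<chi> i. f (d$i)) ** transpose U"
    using V by (simp add: orthogonal_matrix_def)
qed

text \<open>Unit eigenvectors for distinct eigenvalues of a symmetric matrix are orthogonal, and
  there is one for each index. The list \<open>d\<close> is prescribed so that a single
  \<open>d\<close> serves for \<open>S0\<close> and for all matrices along a solution.\<close>

lemma symmetric_diagonalization:
  fixes M :: "'n::finite sqmat"
  assumes sym: "symmetric_matrix M"
    and inj: "inj (\<lambda>i. d$i)" and ev: "\<And>i. d$i \<in> eigenvalues M"
  shows "\<exists>U. orthogonal_matrix U \<and> M = U ** diag_matrix d ** transpose U"
proof -
  have "\<exists>v. norm v = 1 \<and> M *v v = d$i *s v" for i
  proof -
    obtain v where v: "v \<noteq> 0" "M *v v = d$i *s v"
      using ev[of i] by (auto simp: eigenvalues_def)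
    let ?w = "v /\<^sub>R norm v"
    have "M *v ?w = d$i *s ?w"
      using v(2) by (simp add: matrix_vector_mult_scaleR scalar_mult_eq_scaleR)
    then show ?thesis using v(1) by (intro exI[of _ ?w]) simp
  qed
  then obtain v where nv: "\<And>i. norm (v i) = 1" and Mv: "\<And>i. M *v v i = d$i *s v i" by metis
  have orth: "inner (v i) (v j) = 0" if "i \<noteq> j" for i j
  proof -
    have "inner (M *v v i) (v j) = inner (v i) (M *v v j)"
      using sym dot_lmul_matrix[of "v i" M "v j"] vector_transpose_matrix[of "v i" M]
      by (simp add: symmetric_matrix_def)
    then have "(d$i - d$j) * inner (v i) (v j) = 0"
      by (simp add: Mv scalar_mult_eq_scaleR algebra_simps)
    moreover have "d$i \<noteq> d$j" using inj that by (auto simp: inj_def)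
    ultimately show ?thesis by simp
  qed
  define U :: "'n sqmat" where "U = (\<chi> i j. v j $ i)"
  have "transpose U ** U = mat 1"
  proof -
    have "(transpose U ** U) $ i $ j = inner (v i) (v j)" for i j
      by (simp add: matrix_matrix_mult_def transpose_def U_def inner_vec_def)
    then show ?thesis
      using orth nv by (auto simp: vec_eq_iff mat_def simp flip: norm_eq_1)
  qed
  then have U: "orthogonal_matrix U" by (simp add: orthogonal_matrix)
  have "(M ** U) $ i $ j = (U ** diag_matrix d) $ i $ j" for i j
  proof -
    have "(M ** U) $ i $ j = (M *v v j) $ i"
      by (simp add: matrix_matrix_mult_def matrix_vector_mult_def U_def)
    then show ?thesis by (simp add: Mv mult_diag_matrix_component U_def)
  qed
  then have "M ** U = U ** diag_matrix d" by (simp add: vec_eq_iff)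
  then have "M ** (U ** transpose U) = U ** diag_matrix d ** transpose U"
    by (simp add: matrix_mul_assoc)
  then have "M = U ** diag_matrix d ** transpose U"
    using U by (simp add: orthogonal_matrix_transpose_mult)
  then show ?thesis using U by blast
qed

subsection \<open>Differentiable QR factorization\<close>

lemma has_vector_derivative_vecI:
  fixes f :: "real \<Rightarrow> ('a::euclidean_space, 'n::finite) vec"
  assumes "\<And>i. ((\<lambda>t. f t $ i) has_vector_derivative f' $ i) (at x within S)"
  shows "(f has_vector_derivative f') (at x within S)"
  unfolding has_vector_derivative_def
proof (subst has_derivative_componentwise_within, rule ballI)
  fix u :: "('a, 'n) vec" assume "u \<in> Basis"
  then obtain i b where u: "u = axis i b" by (auto simp: Basis_vec_def)
  have "((\<lambda>t. f t $ i \<bullet> b) has_derivative (\<lambda>t. (t *\<^sub>R f' $ i) \<bullet> b)) (at x within S)"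
    using assms[of i] unfolding has_vector_derivative_def by (rule has_derivative_inner_left)
  then show "((\<lambda>t. f t \<bullet> u) has_derivative (\<lambda>t. (t *\<^sub>R f') \<bullet> u)) (at x within S)"
    by (simp add: u inner_axis)
qed

text \<open>Gram-Schmidt adds the indices in increasing order, and each operation in it preserves
  differentiability. The dual family \<open>f\<close> expresses the linear independence of the
  \<open>e j t\<close> at every time.\<close>

lemma gram_schmidt_differentiable:
  fixes e f :: "'n::{finite,linorder} \<Rightarrow> real \<Rightarrow> 'a::real_inner"
  assumes diff: "\<And>j t. e j differentiable (at t)"
    and dual: "\<And>i j t. f i t \<bullet> e j t = (if i = j then 1 else 0)"
  obtains q where "\<And>j t. q j differentiable (at t)"
    and "\<And>i j t. q i t \<bullet> q j t = (if i = j then 1 else 0)"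
    and "\<And>i j t. j < i \<Longrightarrow> q i t \<bullet> e j t = 0"
    and "\<And>j t. 0 < q j t \<bullet> e j t"
proof -
  \<comment> \<open>The last clause, equality of orthogonal complements, stands in for equality of
    the spans of the \<open>q k t\<close> and the \<open>e k t\<close>.\<close>
  have "\<exists>q. (\<forall>j\<in>K. \<forall>t. q j differentiable (at t)) \<and>
      (\<forall>i\<in>K. \<forall>j\<in>K. \<forall>t. q i t \<bullet> q j t = (if i = j then 1 else 0)) \<and>
      (\<forall>i\<in>K. \<forall>j\<in>K. \<forall>t. j < i \<longrightarrow> q i t \<bullet> e j t = 0) \<and>
      (\<forall>j\<in>K. \<forall>t. 0 < q j t \<bullet> e j t) \<and>
      (\<forall>t w. (\<forall>k\<in>K. w \<bullet> q k t = 0) \<longleftrightarrow> (\<forall>k\<in>K. w \<bullet> e k t = 0))"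
    if "finite K" for K
    using that
  proof (induction K rule: finite_linorder_max_induct)
    case empty
    then show ?case by simp
  next
    case (insert b K)
    then obtain q where q: "\<forall>j\<in>K. \<forall>t. q j differentiable (at t)"
      "\<forall>i\<in>K. \<forall>j\<in>K. \<forall>t. q i t \<bullet> q j t = (if i = j then 1 else 0)"
      "\<forall>i\<in>K. \<forall>j\<in>K. \<forall>t. j < i \<longrightarrow> q i t \<bullet> e j t = 0"
      "\<forall>j\<in>K. \<forall>t. 0 < q j t \<bullet> e j t"
      "\<forall>t w. (\<forall>k\<in>K. w \<bullet> q k t = 0) \<longleftrightarrow> (\<forall>k\<in>K. w \<bullet> e k t = 0)"
      by (elim exE conjE)
    have q_diff: "q j differentiable (at t)" if "j \<in> K" for j t
      using q(1) that by simp
    have q_on: "q i t \<bullet> q j t = (if i = j then 1 else 0)" if "i \<in> K" "j \<in> K" for i j t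
      using q(2) that by simp
    have q_perp: "(\<forall>k\<in>K. w \<bullet> q k t = 0) \<longleftrightarrow> (\<forall>k\<in>K. w \<bullet> e k t = 0)" for t w
      using q(5) by blast
    have bK: "b \<notin> K" and Kb: "k \<noteq> b" "\<not> b < k" if "k \<in> K" for k
      using insert.hyps(2) that by (auto dest: order.asym)
    define u where "u t = e b t - (\<Sum>k\<in>K. (q k t \<bullet> e b t) *\<^sub>R q k t)" for t
    have u_perp_q: "u t \<bullet> q j t = 0" if "j \<in> K" for j t
    proof -
      have "(\<Sum>k\<in>K. (q k t \<bullet> e b t) * (q k t \<bullet> q j t))
          = (\<Sum>k\<in>K. if k = j then q j t \<bullet> e b t else 0)"
        using that by (intro sum.cong) (auto simp: q_on)
      then show ?thesis
        using that insert.hyps(1)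
        by (simp add: u_def inner_diff_left inner_sum_left inner_commute[of "e b t"])
    qed
    have u_perp_e: "u t \<bullet> e j t = 0" if "j \<in> K" for j t
      using q_perp[of "u t" t] u_perp_q that by blast
    have w_u: "w \<bullet> u t = w \<bullet> e b t" if "\<forall>k\<in>K. w \<bullet> q k t = 0" for w t
      using that by (simp add: u_def inner_diff_right inner_sum_right)
    \<comment> \<open>The dual vector \<open>f b t\<close> is orthogonal to all earlier vectors, so
      it pairs with \<open>u t\<close> as it does with \<open>e b t\<close>, namely to 1.\<close>
    have u_nz: "u t \<noteq> 0" for t
    proof -
      have "\<forall>k\<in>K. f b t \<bullet> e k t = 0"
        using Kb by (auto simp: dual)
      then have "f b t \<bullet> u t = f b t \<bullet> e b t"
        using q_perp w_u by blast
      then have "f b t \<bullet> u t = 1" by (simp add: dual)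
      then show ?thesis by auto
    qed
    have u_e: "u t \<bullet> e b t = u t \<bullet> u t" for t
      using w_u[of "u t" t] u_perp_q by simp
    have u_diff: "u differentiable (at t)" for t
      unfolding u_def
    proof (intro differentiable_diff[OF diff] differentiable_sum ballI insert.hyps(1))
      fix k assume "k \<in> K"
      note q_diff[OF this]
      then show "(\<lambda>t. (q k t \<bullet> e b t) *\<^sub>R q k t) differentiable (at t)"
        by (intro differentiable_scaleR differentiable_inner diff)
    qed
    define q' where "q' = q(b := \<lambda>t. (1 / norm (u t)) *\<^sub>R u t)"
    have q'b: "q' b t = (1 / norm (u t)) *\<^sub>R u t" for t by (simp add: q'_def)
    have q'K: "q' k = q k" if "k \<in> K" for k using Kb[OF that] by (simp add: q'_def)
    \<comment> \<open>The norm is differentiable only away from 0, hence the need for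
      \<open>u_nz\<close> at every time.\<close>
    have norm_diff: "(\<lambda>t. norm (u t)) differentiable (at t)" for t
      using differentiable_chain_at[OF u_diff differentiable_norm_at[OF u_nz]]
      by (simp add: o_def)
    have "(\<lambda>t. (1 / norm (u t)) *\<^sub>R u t) differentiable (at t)" for t
      by (intro differentiable_scaleR differentiable_divide norm_diff u_diff) (simp_all add: u_nz)
    then have "\<forall>j\<in>insert b K. \<forall>t. q' j differentiable (at t)"
      using q_diff q'K by (auto simp: q'_def)
    moreover have "\<forall>i\<in>insert b K. \<forall>j\<in>insert b K. \<forall>t. q' i t \<bullet> q' j t = (if i = j then 1 else 0)"
    proof -
      have "q' b t \<bullet> q' b t = 1" for t
        using u_nz[of t] by (simp add: q'b power2_eq_square flip: power2_norm_eq_inner)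
      moreover have "q' b t \<bullet> q' j t = 0" "q' j t \<bullet> q' b t = 0" if "j \<in> K" for j t
        using u_perp_q[OF that, of t] by (simp_all add: q'b q'K[OF that] inner_commute)
      ultimately show ?thesis
        using q_on q'K bK by auto
    qed
    moreover have "\<forall>i\<in>insert b K. \<forall>j\<in>insert b K. \<forall>t. j < i \<longrightarrow> q' i t \<bullet> e j t = 0"
      using u_perp_e q(3) q'K Kb by (auto simp: q'b)
    moreover have "\<forall>j\<in>insert b K. \<forall>t. 0 < q' j t \<bullet> e j t"
      using q(4) q'K u_nz by (auto simp: q'b u_e)
    moreover have "(\<forall>k\<in>insert b K. w \<bullet> q' k t = 0) \<longleftrightarrow> (\<forall>k\<in>insert b K. w \<bullet> e k t = 0)" for t w
    proof -
      have "w \<bullet> q' b t = 0 \<longleftrightarrow> w \<bullet> u t = 0" using u_nz[of t] by (simp add: q'b)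
      then show ?thesis
        using q_perp[of w t] w_u[of w t] by (auto simp: q'K)
    qed
    ultimately show ?case by blast
  qed
  from this[OF finite_class.finite_UNIV] obtain q where
    "\<forall>j\<in>UNIV. \<forall>t. q j differentiable (at t)"
    "\<forall>i\<in>UNIV. \<forall>j\<in>UNIV. \<forall>t. q i t \<bullet> q j t = (if i = j then 1 else 0)"
    "\<forall>i\<in>UNIV. \<forall>j\<in>UNIV. \<forall>t. j < i \<longrightarrow> q i t \<bullet> e j t = 0"
    "\<forall>j\<in>UNIV. \<forall>t. 0 < q j t \<bullet> e j t"
    by (elim exE conjE)
  then show thesis by (intro that[of q]) simp_all
qed

text \<open>Gram-Schmidt on the columns of \<open>E t\<close>: the left inverse \<open>F t\<close>
  supplies the dual family as its rows, and the orthonormal vectors become the columns of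
  \<open>Q t\<close>.\<close>

lemma qr_differentiable:
  fixes E :: "real \<Rightarrow> 'n::{finite,linorder} sqmat"
  assumes E: "\<And>t. E differentiable (at t)" and F: "\<And>t. F t ** E t = mat 1"
  obtains Q where "\<And>t. Q differentiable (at t)" "\<And>t. orthogonal_matrix (Q t)"
    "\<And>t. pos_upper_triangular (transpose (Q t) ** E t)"
proof -
  have col: "(\<lambda>t. column j (E t)) differentiable (at t)" for j t
  proof -
    obtain E' where "(E has_vector_derivative E') (at t)"
      using E vector_derivative_works by blast
    then have "((\<lambda>t. E t $ i $ j) has_vector_derivative E' $ i $ j) (at t)" for i
      by (intro bounded_linear.has_vector_derivative[OF bounded_linear_vec_nth])
    then have "((\<lambda>t. column j (E t)) has_vector_derivative column j E') (at t)"
      by (intro has_vector_derivative_vecI) (simp add: column_def)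
    then show ?thesis
      by (auto simp: has_vector_derivative_def differentiable_def)
  qed
  have dual: "row i (F t) \<bullet> column j (E t) = (if i = j then 1 else 0)" for i j t
  proof -
    have "row i (F t) \<bullet> column j (E t) = (F t ** E t) $ i $ j"
      by (simp add: inner_vec_def row_def column_def matrix_matrix_mult_def)
    then show ?thesis by (simp add: F mat_def)
  qed
  obtain q where q: "\<And>j t. q j differentiable (at t)"
      "\<And>i j t. q i t \<bullet> q j t = (if i = j then 1 else 0)"
      "\<And>i j t. j < i \<Longrightarrow> q i t \<bullet> column j (E t) = 0"
      "\<And>j t. 0 < q j t \<bullet> column j (E t)"
    using gram_schmidt_differentiable[OF col dual] by metis
  define Q :: "real \<Rightarrow> 'n sqmat" where "Q t = (\<chi> i j. q j t $ i)" for t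
  show thesis
  proof (rule that)
    fix t
    define q' where "q' j = vector_derivative (q j) (at t)" for j
    have q': "(q j has_vector_derivative q' j) (at t)" for j
      using q(1)[of j t] by (simp add: q'_def vector_derivative_works)
    have "(Q has_vector_derivative (\<chi> i j. q' j $ i)) (at t)"
      by (intro has_vector_derivative_vecI)
        (simp add: Q_def bounded_linear.has_vector_derivative[OF bounded_linear_vec_nth q'])
    then show "Q differentiable (at t)"
      by (auto simp: has_vector_derivative_def differentiable_def)
    have "(transpose (Q t) ** Q t) $ i $ j = q i t \<bullet> q j t" for i j
      by (simp add: inner_vec_def Q_def transpose_def matrix_matrix_mult_def)
    then show "orthogonal_matrix (Q t)"
      by (simp add: orthogonal_matrix vec_eq_iff q(2) mat_def)
    have "(transpose (Q t) ** E t) $ i $ j = q i t \<bullet> column j (E t)" for i j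
      by (simp add: inner_vec_def Q_def column_def transpose_def matrix_matrix_mult_def)
    then show "pos_upper_triangular (transpose (Q t) ** E t)"
      by (simp add: pos_upper_triangular_def upper_triangular_def q(3,4))
  qed
qed

text \<open>
  With \<open>R = Q\<^sup>T E\<close> and \<open>E' = L E\<close> one gets \<open>R' = (Q\<^sup>T L Q - Q\<^sup>T Q') R\<close>.  So
  \<open>Q\<^sup>T L Q - Q\<^sup>T Q'\<close> is upper triangular, while \<open>Q\<^sup>T Q'\<close> is skew.
\<close>

lemma qr_orthogonal_factor_derivative:
  fixes E Q :: "real \<Rightarrow> 'n::{finite,linorder} sqmat"
  assumes E: "(E has_vector_derivative L ** E t) (at t)"
    and Q: "(Q has_vector_derivative Q') (at t)"
    and orth: "\<And>s. orthogonal_matrix (Q s)"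
    and R: "\<And>s. pos_upper_triangular (transpose (Q s) ** E s)"
  shows "transpose (Q t) ** Q' = skew_part (transpose (Q t) ** L ** Q t)"
    and "transpose Q' ** Q t = - skew_part (transpose (Q t) ** L ** Q t)"
proof -
  let ?A = "transpose (Q t) ** Q'" and ?L = "transpose (Q t) ** L ** Q t"
  let ?R = "\<lambda>s. transpose (Q s) ** E s"
  note orth_simps = orthogonal_matrix_transpose_mult[OF orth]
  have Q_T: "((\<lambda>s. transpose (Q s)) has_vector_derivative transpose Q') (at t)"
    by (rule bounded_linear.has_vector_derivative[OF bounded_linear_transpose Q])
  have "((\<lambda>s. transpose (Q s) ** Q s) has_vector_derivative
      transpose (Q t) ** Q' + transpose Q' ** Q t) (at t)"
    by (rule bounded_bilinear.has_vector_derivative[OF bounded_bilinear_matrix_mult Q_T Q])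
  then have "((\<lambda>s. mat 1) has_vector_derivative ?A + transpose Q' ** Q t) (at t)"
    by (simp add: orth_simps)
  then have "?A + transpose Q' ** Q t = 0"
    by (rule vector_derivative_unique_at) (rule has_vector_derivative_const)
  then have skew1: "transpose Q' ** Q t = - ?A" by (simp add: add_eq_0_iff)
  have "transpose ?A = transpose Q' ** Q t" by (simp add: matrix_transpose_mul)
  then have skew: "?A $ j $ i = - ?A $ i $ j" for i j
  proof -
    have "?A $ j $ i = transpose ?A $ i $ j" unfolding transpose_def vec_lambda_beta ..
    also have "transpose ?A = - ?A" using \<open>transpose ?A = transpose Q' ** Q t\<close> skew1 by (rule trans)
    finally show ?thesis by (simp only: vector_uminus_component)
  qed
  have R': "(?R has_vector_derivative transpose (Q t) ** (L ** E t) + transpose Q' ** E t) (at t)"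
    by (rule bounded_bilinear.has_vector_derivative[OF bounded_bilinear_matrix_mult Q_T E])
  \<comment> \<open>Writing \<open>E t\<close> as \<open>Q t ** ?R t\<close> makes
    \<open>?R t\<close> a right factor of the whole derivative.\<close>
  have "transpose Q' ** E t = (transpose Q' ** Q t) ** ?R t"
    by (simp add: orth_simps flip: matrix_mul_assoc)
  also have "\<dots> = - ?A ** ?R t" by (simp add: skew1)
  finally have R'': "(?R has_vector_derivative (?L - ?A) ** ?R t) (at t)"
    using R' by (simp add: matrix_diff_right_distrib matrix_minus_left orth_simps
        flip: matrix_mul_assoc)
  \<comment> \<open>This entry is the derivative of an entry of \<open>?R\<close> that is zero at
    all times.\<close>
  have "((?L - ?A) ** ?R t) $ i $ j = 0" if "j < i" for i j
  proof -
    have entry': "((\<lambda>s. ?R s $ i $ j) has_vector_derivative ((?L - ?A) ** ?R t) $ i $ j) (at t)"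
      by (intro bounded_linear.has_vector_derivative[OF bounded_linear_vec_nth] R'')
    have entry: "(\<lambda>s. ?R s $ i $ j) = (\<lambda>s. 0)"
    proof
      fix s
      show "?R s $ i $ j = 0"
        using R[of s] that unfolding pos_upper_triangular_def upper_triangular_def by blast
    qed
    have "((\<lambda>s. 0) has_vector_derivative ((?L - ?A) ** ?R t) $ i $ j) (at t)"
      using entry' unfolding entry .
    then show ?thesis
      by (rule vector_derivative_unique_at) (rule has_vector_derivative_const)
  qed
  then have "upper_triangular ((?L - ?A) ** ?R t)"
    unfolding upper_triangular_def by blast
  then have "upper_triangular (?L - ?A)"
    by (rule upper_triangular_cancel[OF R[of t]])
  then have low: "?A $ i $ j = ?L $ i $ j" if "j < i" for i j
    using that by (simp add: upper_triangular_def)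
  \<comment> \<open>The strictly lower parts of \<open>?A\<close> and \<open>?L\<close> agree;
    skewness of \<open>?A\<close> determines the other entries.\<close>
  have "?A $ i $ j = skew_part ?L $ i $ j" for i j
  proof (cases i j rule: linorder_cases)
    case less
    then have "\<not> j < i" by auto
    then show ?thesis using less low[of i j] skew[of i j] by (simp add: skew_part_def)
  next
    case equal
    then show ?thesis using skew[of i i] by (simp add: skew_part_def)
  qed (simp add: skew_part_def low)
  then show A: "?A = skew_part ?L" by (simp add: vec_eq_iff)
  show "transpose Q' ** Q t = - skew_part ?L" using skew1 A by simp
qed

subsection \<open>The interpolating flow\<close>

text \<open>With L = U diag(c) U^T, \<open>E t\<close> is the matrix exponential of tL written in
  the eigenbasis of L; the claim is E' = L E.\<close>

lemma has_vector_derivative_conj_diag_exp: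
  fixes U :: "'n::finite sqmat" and c :: "(real, 'n) vec"
  assumes U: "orthogonal_matrix U"
  defines "E \<equiv> \<lambda>t. U ** diag_matrix (\<chi> i. exp (t * c$i)) ** transpose U"
  shows "(E has_vector_derivative (U ** diag_matrix c ** transpose U) ** E t) (at t)"
proof -
  note bilin = bounded_bilinear.has_vector_derivative[OF bounded_bilinear_matrix_mult]
  have "((\<lambda>t. if i = j then exp (t * c$i) else 0) has_vector_derivative
      (if i = j then c$i * exp (t * c$i) else 0)) (at t)" for i j
    unfolding has_real_derivative_iff_has_vector_derivative[symmetric]
    by (auto intro!: derivative_eq_intros)
  then have "((\<lambda>t. diag_matrix (\<chi> i. exp (t * c$i))) has_vector_derivative
      diag_matrix (\<chi> i. c$i * exp (t * c$i))) (at t)"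
    by (intro has_vector_derivative_vecI) (simp only: diag_matrix_def vec_lambda_beta)
  then have "(E has_vector_derivative
      U ** diag_matrix (\<chi> i. c$i * exp (t * c$i)) ** transpose U) (at t)"
    unfolding E_def
    using bilin[OF bilin[OF has_vector_derivative_const] has_vector_derivative_const] by fastforce
  then show ?thesis
    by (simp add: E_def conj_diag_mult[OF U])
qed

text \<open>Here \<open>c\<close> lists the eigenvalues of ln S0. Starting from exponentials makes
  \<open>S0\<close> positive by construction and its logarithm explicit.\<close>

lemma qr_flow_interpolates:
  fixes U :: "'n::{finite,linorder} sqmat" and c :: "(real, 'n) vec"
  assumes U: "orthogonal_matrix U"
  defines "S0 \<equiv> U ** diag_matrix (\<chi> i. exp (c$i)) ** transpose U"
  obtains S where "qr_flow_solution UNIV S0 S" "\<And>m. S (real m) = qr_sequence S0 m"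
proof -
  define E where "E t = U ** diag_matrix (\<chi> i. exp (t * c$i)) ** transpose U" for t
  define L where "L = U ** diag_matrix c ** transpose U"
  have E': "(E has_vector_derivative L ** E t) (at t)" for t
    using has_vector_derivative_conj_diag_exp[OF U] by (simp add: E_def[abs_def] L_def)
  have E_add: "E s ** E t = E (s + t)" for s t
    by (simp add: E_def conj_diag_mult[OF U] distrib_right exp_add)
  have "diag_matrix (\<chi> i. 1) = (mat 1 :: 'n sqmat)"
    by (simp add: diag_matrix_def mat_def vec_eq_iff)
  then have E0: "E 0 = mat 1"
    using U by (simp add: E_def orthogonal_matrix_def)
  have E1: "E 1 = S0" by (simp add: E_def S0_def)
  have E_diff: "E differentiable (at t)" for t
    using E'[of t] by (auto simp: has_vector_derivative_def differentiable_def)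
  have E_inv: "E (- t) ** E t = mat 1" for t by (simp add: E_add E0)
  obtain Q where Q_diff: "\<And>t. Q differentiable (at t)"
    and Q_orth: "\<And>t. orthogonal_matrix (Q t)"
    and R_pos: "\<And>t. pos_upper_triangular (transpose (Q t) ** E t)"
    using qr_differentiable[OF E_diff E_inv] by metis
  note orth_simps = orthogonal_matrix_transpose_mult[OF Q_orth]
  define S where "S t = transpose (Q t) ** S0 ** Q t" for t
  have S_conj: "S t = V ** diag_matrix (\<chi> i. exp (c$i)) ** transpose V"
    \<comment> \<open>Conjugation by \<open>Q t\<close> turns the eigenbasis \<open>U\<close> into
      \<open>V\<close> and keeps the eigenvalues, so the logarithm of \<open>S t\<close> can be read
      off.\<close>
    and L_conj: "transpose (Q t) ** L ** Q t = V ** diag_matrix c ** transpose V"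
    if "V = transpose (Q t) ** U" for t V
    using that by (simp_all add: S_def S0_def L_def matrix_transpose_mul matrix_mul_assoc)
  have V_orth: "orthogonal_matrix (transpose (Q t) ** U)" for t
    by (intro orthogonal_matrix_mul U) (simp add: Q_orth)
  have ln_S: "matrix_ln (S t) = transpose (Q t) ** L ** Q t" for t
    by (simp add: S_conj[OF refl] L_conj[OF refl] matrix_ln_def
        spectral_calculus_conj_diag[OF V_orth])
  have S': "(S has_vector_derivative mat_commutator (S t) (skew_part (matrix_ln (S t)))) (at t)" for t
  proof -
    obtain Q' where Q': "(Q has_vector_derivative Q') (at t)"
      using Q_diff vector_derivative_works by blast
    let ?A = "skew_part (matrix_ln (S t))"
    have A: "transpose (Q t) ** Q' = ?A" "transpose Q' ** Q t = - ?A"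
      using qr_orthogonal_factor_derivative[OF E' Q' Q_orth R_pos] ln_S by simp_all
    have "((\<lambda>s. transpose (Q s)) has_vector_derivative transpose Q') (at t)"
      by (rule bounded_linear.has_vector_derivative[OF bounded_linear_transpose Q'])
    note d1 = bounded_bilinear.has_vector_derivative[OF bounded_bilinear_matrix_mult this
        has_vector_derivative_const[of S0]]
    note d2 = bounded_bilinear.has_vector_derivative[OF bounded_bilinear_matrix_mult d1 Q']
    \<comment> \<open>The identity \<open>Q t ** transpose (Q t) = mat 1\<close> is inserted next to
      \<open>Q'\<close>, and below next to \<open>transpose Q'\<close>, so that the product rule
      yields the commutator with \<open>?A\<close>.\<close>
    have "transpose (Q t) ** S0 ** Q' = transpose (Q t) ** S0 ** (Q t ** (transpose (Q t) ** Q'))"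
      by (simp add: orth_simps)
    also have "\<dots> = S t ** ?A"
      unfolding A by (simp add: S_def matrix_mul_assoc)
    finally have 1: "transpose (Q t) ** S0 ** Q' = S t ** ?A" .
    have "transpose Q' ** S0 ** Q t = (transpose Q' ** Q t) ** (transpose (Q t) ** (S0 ** Q t))"
      by (simp add: orth_simps flip: matrix_mul_assoc)
    also have "\<dots> = - (?A ** S t)"
      unfolding A by (simp add: S_def matrix_mul_assoc matrix_minus_left)
    finally have 2: "transpose Q' ** S0 ** Q t = - (?A ** S t)" .
    show ?thesis
      using d2 by (simp add: 1 2 mat_commutator_def flip: S_def)
  qed
  have det_E: "0 < det (E t)" for t
  proof -
    have "det (diag_matrix (\<chi> i. exp (t * c$i)) :: 'n sqmat) = (\<Prod>i\<in>UNIV. exp (t * c$i))"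
      by (subst det_upper_triangular) (auto simp: upper_triangular_def diag_matrix_def)
    moreover have "det U * det (transpose U) = 1"
      using U by (metis det_I det_mul orthogonal_matrix_def)
    ultimately have "det (E t) = (\<Prod>i\<in>UNIV. exp (t * c$i))"
      by (simp add: E_def det_mul mult_ac)
    then show ?thesis by (simp add: prod_pos)
  qed
  \<comment> \<open>\<open>E t\<close> and the triangular factor have positive determinant, which
    selects +1 from the two values open to an orthogonal matrix; \<open>qr_factorization\<close>
    asks for a rotation.\<close>
  have Q_rot: "det (Q t) = 1" for t
  proof -
    have "0 < det (transpose (Q t) ** E t)"
      using R_pos[of t] by (simp add: det_upper_triangular pos_upper_triangular_def prod_pos)
    then have "0 < det (Q t)"
      using det_E[of t] by (simp add: det_mul zero_less_mult_iff)
    then show ?thesis using det_orthogonal_matrix[OF Q_orth[of t]] by auto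
  qed
  \<comment> \<open>At time 0 the triangular factor is \<open>transpose (Q 0)\<close>
    itself.\<close>
  have Q0: "Q 0 = mat 1"
  proof -
    have "pos_upper_triangular (transpose (Q 0))" using R_pos[of 0] by (simp add: E0)
    then have "transpose (Q 0) = mat 1"
      by (intro orthogonal_pos_upper_triangular) (simp add: Q_orth)
    then show ?thesis by (metis transpose_mat transpose_transpose)
  qed
  have S_0: "S 0 = S0" by (simp add: S_def Q0)
  have "S (real m) = qr_sequence S0 m" for m
  proof (induction m)
    case 0
    then show ?case by (simp add: S_0)
  next
    case (Suc m)
    define s where "s = real m"
    \<comment> \<open>These are the QR factors of \<open>S s\<close>. With R = Q^T E, the identity
      \<open>S0 ** E s = E (s + 1)\<close> gives N R(s) = R(s+1), which makes \<open>?N\<close>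
      triangular; multiplied in the opposite order the factors give
      \<open>S (s + 1)\<close>.\<close>
    let ?P = "transpose (Q s) ** Q (s + 1)"
    let ?N = "transpose (Q (s + 1)) ** S0 ** Q s"
    have "S0 ** E s = E (s + 1)" by (simp add: E_add add.commute flip: E1)
    then have "?N ** (transpose (Q s) ** E s) = transpose (Q (s + 1)) ** E (s + 1)"
      by (simp add: orth_simps flip: matrix_mul_assoc)
    then have N: "pos_upper_triangular ?N"
      using pos_upper_triangular_cancel[OF R_pos[of s], of ?N] R_pos[of "s + 1"] by simp
    have "rotation_matrix ?P"
      unfolding rotation_matrix_def
      by (intro conjI orthogonal_matrix_mul Q_orth) (simp_all add: Q_orth det_mul Q_rot)
    moreover have "S s = ?P ** ?N"
      by (simp add: S_def orth_simps flip: matrix_mul_assoc)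
    ultimately have "qr_factorization (S s) = (?P, ?N)"
      using qr_factorization_eqI N by blast
    moreover have "?N ** ?P = S (s + 1)"
      by (simp add: S_def orth_simps flip: matrix_mul_assoc)
    ultimately show ?case
      using Suc.IH by (simp add: s_def add.commute)
  qed
  moreover have "qr_flow_solution UNIV S0 S"
    unfolding qr_flow_solution_def
  proof (intro conjI ballI S_0 S')
    fix t
    show "symmetric_matrix (S t)"
      by (simp only: S_conj[OF refl] symmetric_matrix_conj_diag)
    show "positive_spectrum (S t)"
      by (auto simp: positive_spectrum_def S_conj[OF refl] eigenvalues_conj_diag[OF V_orth])
  qed
  ultimately show thesis using that by blast
qed

subsection \<open>Products of shifted matrices\<close>

text \<open>The monic polynomial with the listed roots, evaluated at \<open>M\<close>. Annihilating
  products and Lagrange basis polynomials both have this factored form, up to a scalar.\<close>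

primrec shifted_prod :: "'n::finite sqmat \<Rightarrow> real list \<Rightarrow> 'n sqmat" where
  "shifted_prod M [] = mat 1"
| "shifted_prod M (c # cs) = (M - mat c) ** shifted_prod M cs"

lemma mat_mult_commute: "mat c ** M = M ** mat c" for M :: "'n::finite sqmat"
  by (simp add: vec_eq_iff matrix_matrix_mult_def mat_def mult_delta_left mult_delta_right)

lemma transpose_diff: "transpose (A - B) = transpose A - transpose B" for A B :: "'n::finite sqmat"
  by (simp add: transpose_def vec_eq_iff)

lemma shift_shifted_prod_commute:
  "(M - mat a) ** shifted_prod M cs = shifted_prod M cs ** (M - mat a)"
proof (induction cs)
  case (Cons c cs)
  have "(M - mat a) ** (M - mat c) = (M - mat c) ** (M - mat a)"
    by (simp add: matrix_diff_left_distrib matrix_diff_right_distrib mat_mult_commute[of _ M]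
        mat_mult_commute[of a "mat c"])
  then show ?case
    using Cons.IH by (metis matrix_mul_assoc shifted_prod.simps(2))
qed simp

text \<open>Transposition reverses the order of the factors, and commutation restores it.\<close>

lemma transpose_shifted_prod:
  assumes "transpose M = M"
  shows "transpose (shifted_prod M cs) = shifted_prod M cs"
proof (induction cs)
  case (Cons c cs)
  then show ?case
    unfolding shifted_prod.simps(2) matrix_transpose_mul transpose_diff transpose_mat assms
    by (simp only: shift_shifted_prod_commute)
qed simp

lemma mat_mult_vector: "mat c *v v = c *s v" for v :: "(real, 'n::finite) vec"
  by (simp add: vec_eq_iff matrix_vector_mult_def mat_def mult_delta_left)

lemma shifted_prod_conj:
  fixes U :: "'n::finite sqmat"
  assumes U: "orthogonal_matrix U"
  shows "shifted_prod (U ** diag_matrix d ** transpose U) cs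
    = U ** diag_matrix (\<chi> i. \<Prod>c\<leftarrow>cs. d$i - c) ** transpose U"
proof (induction cs)
  case Nil
  have "diag_matrix (\<chi> i. 1) = (mat 1 :: 'n sqmat)"
    by (simp add: diag_matrix_def mat_def vec_eq_iff)
  then show ?case using U by (simp add: orthogonal_matrix_def)
next
  case (Cons c cs)
  have "mat c = U ** mat c ** transpose U"
    unfolding mat_mult_commute[of c U, symmetric]
    by (simp add: orthogonal_matrix_transpose_mult[OF U] flip: matrix_mul_assoc)
  moreover have "diag_matrix d - mat c = diag_matrix (\<chi> i. d$i - c)"
    by (simp add: diag_matrix_def mat_def vec_eq_iff)
  ultimately have "U ** diag_matrix d ** transpose U - mat c
      = U ** diag_matrix (\<chi> i. d$i - c) ** transpose U"
    by (metis matrix_diff_left_distrib matrix_diff_right_distrib)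
  then show ?case
    by (simp add: Cons.IH conj_diag_mult[OF U])
qed

text \<open>The bracket with \<open>A\<close> is a derivation that kills scalar matrices, so the
  equation T' = [T, A] passes to products of shifts of \<open>T\<close>.\<close>

lemma has_vector_derivative_shifted_prod:
  fixes T :: "real \<Rightarrow> 'n::finite sqmat"
  assumes T: "(T has_vector_derivative mat_commutator (T t) A) (at t within I)"
  shows "((\<lambda>s. shifted_prod (T s) cs) has_vector_derivative
    mat_commutator (shifted_prod (T t) cs) A) (at t within I)"
proof (induction cs)
  case Nil
  then show ?case by (simp add: mat_commutator_def)
next
  case (Cons c cs)
  let ?p = "shifted_prod (T t) cs" and ?M = "T t - mat c"
  have "((\<lambda>s. T s - mat c) has_vector_derivative mat_commutator (T t) A) (at t within I)"
    using has_vector_derivative_diff[OF T has_vector_derivative_const] by simp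
  from bounded_bilinear.has_vector_derivative[OF bounded_bilinear_matrix_mult this Cons.IH]
  have "((\<lambda>s. shifted_prod (T s) (c # cs)) has_vector_derivative
      ?M ** mat_commutator ?p A + mat_commutator (T t) A ** ?p) (at t within I)"
    by simp
  moreover have "?M ** mat_commutator ?p A + mat_commutator (T t) A ** ?p
      = mat_commutator (shifted_prod (T t) (c # cs)) A"
    by (simp add: mat_commutator_def matrix_diff_left_distrib matrix_diff_right_distrib
        matrix_mul_assoc mat_mult_commute[of c A])
  ultimately show ?case by simp
qed

subsection \<open>Isospectrality and uniqueness\<close>

lemma has_vector_derivative_inner_self:
  fixes f :: "real \<Rightarrow> 'a::real_inner"
  assumes "(f has_vector_derivative f') (at t within I)"
  shows "((\<lambda>t. f t \<bullet> f t) has_real_derivative 2 * (f t \<bullet> f')) (at t within I)"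
  using bounded_bilinear.has_vector_derivative[OF bounded_bilinear_inner assms assms]
  by (simp add: has_real_derivative_iff_has_vector_derivative inner_commute)

text \<open>To the right of 0 the product exp(-C s) h(s) cannot increase, to the left exp(C s) h(s)
  cannot decrease. Both start from 0, so \<open>h t\<close> is at most 0. The mean value theorem is
  applied on the segment between 0 and \<open>t\<close>.\<close>

lemma gronwall_zero:
  fixes h :: "real \<Rightarrow> real"
  assumes I: "is_interval I" "0 \<in> I" "t \<in> I"
    and h': "\<And>s. s \<in> I \<Longrightarrow> (h has_real_derivative h' s) (at s within I)"
    and bound: "\<And>s. s \<in> I \<Longrightarrow> \<bar>h' s\<bar> \<le> C * h s"
    and h0: "h 0 = 0" and nonneg: "\<And>s. s \<in> I \<Longrightarrow> 0 \<le> h s"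
  shows "h t = 0"
proof (cases "0 \<le> t")
  case True
  have sub: "{0..t} \<subseteq> I" using I unfolding is_interval_1 by (meson atLeastAtMost_iff subsetI)
  have "((\<lambda>s. exp (- C * s) * h s) has_derivative
      (*) (exp (- C * s) * (h' s - C * h s))) (at s within {0..t})" if "0 \<le> s" "s \<le> t" for s
  proof -
    have "(h has_real_derivative h' s) (at s within {0..t})"
      using h' sub that by (meson DERIV_subset atLeastAtMost_iff subsetD)
    then have "((\<lambda>s. exp (- C * s) * h s) has_real_derivative
        exp (- C * s) * (h' s - C * h s)) (at s within {0..t})"
      by (auto intro!: derivative_eq_intros simp: algebra_simps)
    then show ?thesis unfolding has_field_derivative_def .
  qed
  from mvt_very_simple[OF True this] obtain s where s: "s \<in> {0..t}"
    "exp (- C * t) * h t = exp (- C * s) * (h' s - C * h s) * t"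
    using h0 by auto
  have "h' s - C * h s \<le> 0" using bound[of s] s(1) sub by auto
  then have "exp (- C * t) * h t \<le> 0"
    unfolding s(2) using True by (intro mult_nonpos_nonneg mult_nonneg_nonpos) auto
  then have "h t \<le> 0" by (simp add: mult_le_0_iff)
  then show ?thesis using nonneg[OF I(3)] by simp
next
  case False
  then have le: "t \<le> 0" by simp
  have sub: "{t..0} \<subseteq> I" using I unfolding is_interval_1 by (meson atLeastAtMost_iff subsetI)
  have "((\<lambda>s. exp (C * s) * h s) has_derivative
      (*) (exp (C * s) * (h' s + C * h s))) (at s within {t..0})" if "t \<le> s" "s \<le> 0" for s
  proof -
    have "(h has_real_derivative h' s) (at s within {t..0})"
      using h' sub that by (meson DERIV_subset atLeastAtMost_iff subsetD)
    then have "((\<lambda>s. exp (C * s) * h s) has_real_derivative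
        exp (C * s) * (h' s + C * h s)) (at s within {t..0})"
      by (auto intro!: derivative_eq_intros simp: algebra_simps)
    then show ?thesis unfolding has_field_derivative_def .
  qed
  from mvt_very_simple[OF le this] obtain s where s: "s \<in> {t..0}"
    "- (exp (C * t) * h t) = exp (C * s) * (h' s + C * h s) * (- t)"
    using h0 by auto
  have "0 \<le> h' s + C * h s" using bound[of s] s(1) sub by auto
  then have "0 \<le> - (exp (C * t) * h t)"
    unfolding s(2) using le by (intro mult_nonneg_nonneg) auto
  then have "h t \<le> 0" by (simp add: mult_le_0_iff)
  then show ?thesis using nonneg[OF I(3)] by simp
qed

text \<open>Used in two ways: a product vanishes at \<open>T t\<close> exactly when it vanishes at
  \<open>S0\<close>, and the list \<open>[0]\<close> bounds the solution itself.\<close>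

lemma qr_flow_norm_shifted_prod:
  fixes T :: "real \<Rightarrow> 'n::{finite,linorder} sqmat"
  assumes I: "is_interval I" "0 \<in> I" "t \<in> I" and T: "qr_flow_solution I S0 T"
  shows "norm (shifted_prod (T t) cs) = norm (shifted_prod S0 cs)"
proof -
  define p where "p s = shifted_prod (T s) cs" for s
  have "((\<lambda>s. p s \<bullet> p s) has_real_derivative 0) (at s within I)" if "s \<in> I" for s
  proof -
    let ?A = "skew_part (matrix_ln (T s))"
    have "(T has_vector_derivative mat_commutator (T s) ?A) (at s within I)"
      using T that by (simp add: qr_flow_solution_def)
    then have "(p has_vector_derivative mat_commutator (p s) ?A) (at s within I)"
      unfolding p_def by (rule has_vector_derivative_shifted_prod)
    note has_vector_derivative_inner_self[OF this]
    moreover have "p s \<bullet> mat_commutator (p s) ?A = 0"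
      using T that unfolding p_def
      by (intro inner_commutator_skew transpose_shifted_prod transpose_skew_part)
        (simp add: qr_flow_solution_def symmetric_matrix_def)
    ultimately show ?thesis by simp
  qed
  then obtain k where "\<And>s. s \<in> I \<Longrightarrow> p s \<bullet> p s = k"
    using has_field_derivative_zero_constant[of I "\<lambda>s. p s \<bullet> p s"] I(1) is_interval_convex_1
    by blast
  then have "p t \<bullet> p t = p 0 \<bullet> p 0" using I by simp
  then show ?thesis
    using T by (simp add: p_def qr_flow_solution_def norm_eq_sqrt_inner)
qed

text \<open>
  The annihilating product of \<open>S0\<close> keeps vanishing along a solution and every proper factor of it
  keeps not vanishing, so no eigenvalue gets lost.
\<close>

lemma qr_flow_eigenvalue:
  fixes T :: "real \<Rightarrow> 'n::{finite,linorder} sqmat"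
  assumes I: "is_interval I" "0 \<in> I" "t \<in> I" and T: "qr_flow_solution I S0 T"
    and cs: "shifted_prod S0 (a # cs) = 0" "shifted_prod S0 cs \<noteq> 0"
  shows "a \<in> eigenvalues (T t)"
proof -
  have "shifted_prod (T t) cs \<noteq> 0"
    using qr_flow_norm_shifted_prod[OF I T, of cs] cs(2) by (metis norm_eq_zero)
  then obtain w where w: "shifted_prod (T t) cs *v w \<noteq> 0"
    by (metis matrix_eq matrix_vector_mult_0)
  \<comment> \<open>Once \<open>T t - mat a\<close> annihilates the range of the product, any
    nonzero vector of that range is an eigenvector.\<close>
  let ?v = "shifted_prod (T t) cs *v w"
  have "shifted_prod (T t) (a # cs) = 0"
    using qr_flow_norm_shifted_prod[OF I T, of "a # cs"] cs(1) by (metis norm_eq_zero)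
  then have "(T t - mat a) *v ?v = 0"
    by (simp add: matrix_vector_mul_assoc)
  then have "T t *v ?v = a *s ?v"
    by (simp add: matrix_vector_mult_diff_rdistrib mat_mult_vector)
  then show ?thesis using w by (auto simp: eigenvalues_def)
qed

section \<open>Maps that are Lipschitz on every bounded set\<close>

definition lipschitz_bounded :: "('a::real_normed_vector \<Rightarrow> 'b::real_normed_vector) \<Rightarrow> bool" where
  "lipschitz_bounded F \<longleftrightarrow>
    (\<forall>K. \<exists>C. \<forall>X Y. norm X \<le> K \<longrightarrow> norm Y \<le> K \<longrightarrow> norm (F X - F Y) \<le> C * norm (X - Y))"

text \<open>Comparison with \<open>F 0\<close> turns a Lipschitz constant into a bound on the ball.
  One constant is enlarged to serve for both, as needed for bilinear products.\<close>

lemma lipschitz_boundedE: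
  assumes "lipschitz_bounded F"
  obtains C where "0 \<le> C"
    "\<And>X Y. norm X \<le> K \<Longrightarrow> norm Y \<le> K \<Longrightarrow> norm (F X - F Y) \<le> C * norm (X - Y)"
    "\<And>X. norm X \<le> K \<Longrightarrow> norm (F X) \<le> C"
proof -
  obtain C where C: "\<And>X Y. norm X \<le> K \<Longrightarrow> norm Y \<le> K \<Longrightarrow> norm (F X - F Y) \<le> C * norm (X - Y)"
    using assms unfolding lipschitz_bounded_def by blast
  let ?C = "\<bar>C\<bar> * (1 + \<bar>K\<bar>) + norm (F 0)"
  show thesis
  proof (rule that)
    have "\<bar>C\<bar> * 1 \<le> \<bar>C\<bar> * (1 + \<bar>K\<bar>)" by (intro mult_left_mono) auto
    then have C_le: "C \<le> ?C" using norm_ge_zero[of "F 0"] by linarith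
    show "0 \<le> ?C" by simp
    show "norm (F X - F Y) \<le> ?C * norm (X - Y)" if "norm X \<le> K" "norm Y \<le> K" for X Y
      using C[OF that] mult_right_mono[OF C_le, of "norm (X - Y)"] by simp
    show "norm (F X) \<le> ?C" if X: "norm X \<le> K" for X
    proof -
      have K: "0 \<le> K" using X norm_ge_zero order_trans by blast
      have "norm (F X) \<le> norm (F X - F 0) + norm (F 0)"
        using norm_triangle_sub[of "F X" "F 0"] by simp
      moreover have "norm (F X - F 0) \<le> C * norm X" using C[OF X, of 0] K by simp
      moreover have "C * norm X \<le> \<bar>C\<bar> * (1 + \<bar>K\<bar>)" using X K by (intro mult_mono) auto
      ultimately show ?thesis by simp
    qed
  qed
qed

lemma lipschitz_bounded_linear:
  assumes "bounded_linear f" shows "lipschitz_bounded f"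
proof -
  interpret bounded_linear f by fact
  obtain C where "\<And>x. norm (f x) \<le> norm x * C" using bounded by blast
  then have "norm (f X - f Y) \<le> C * norm (X - Y)" for X Y
    by (metis diff mult.commute)
  then show ?thesis unfolding lipschitz_bounded_def by blast
qed

lemma lipschitz_bounded_const: "lipschitz_bounded (\<lambda>X. A)"
  unfolding lipschitz_bounded_def by (auto intro!: exI[of _ 0])

lemma lipschitz_bounded_compose_linear:
  assumes f: "bounded_linear f" and F: "lipschitz_bounded F"
  shows "lipschitz_bounded (\<lambda>X. f (F X))"
  unfolding lipschitz_bounded_def
proof
  fix K
  interpret bounded_linear f by fact
  obtain B where B: "0 \<le> B" "\<And>x. norm (f x) \<le> norm x * B" using nonneg_bounded by blast
  obtain C where C: "\<And>X Y. norm X \<le> K \<Longrightarrow> norm Y \<le> K \<Longrightarrow> norm (F X - F Y) \<le> C * norm (X - Y)"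
    using lipschitz_boundedE[OF F] by metis
  have "norm (f (F X) - f (F Y)) \<le> (C * B) * norm (X - Y)" if "norm X \<le> K" "norm Y \<le> K" for X Y
    using B(2)[of "F X - F Y"] mult_right_mono[OF C[OF that] B(1)] by (simp add: diff mult_ac)
  then show "\<exists>C. \<forall>X Y. norm X \<le> K \<longrightarrow> norm Y \<le> K \<longrightarrow> norm (f (F X) - f (F Y)) \<le> C * norm (X - Y)"
    by blast
qed

lemma lipschitz_bounded_add:
  assumes F: "lipschitz_bounded F" and G: "lipschitz_bounded G"
  shows "lipschitz_bounded (\<lambda>X. F X + G X)"
  unfolding lipschitz_bounded_def
proof
  fix K
  obtain C where C: "\<And>X Y. norm X \<le> K \<Longrightarrow> norm Y \<le> K \<Longrightarrow> norm (F X - F Y) \<le> C * norm (X - Y)"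
    using lipschitz_boundedE[OF F] by metis
  obtain D where D: "\<And>X Y. norm X \<le> K \<Longrightarrow> norm Y \<le> K \<Longrightarrow> norm (G X - G Y) \<le> D * norm (X - Y)"
    using lipschitz_boundedE[OF G] by metis
  have "norm ((F X + G X) - (F Y + G Y)) \<le> (C + D) * norm (X - Y)"
    if "norm X \<le> K" "norm Y \<le> K" for X Y
    using norm_diff_triangle_ineq[of "F X" "G X" "F Y" "G Y"] C[OF that] D[OF that]
    by (simp add: distrib_right)
  then show "\<exists>C. \<forall>X Y. norm X \<le> K \<longrightarrow> norm Y \<le> K \<longrightarrow>
      norm ((F X + G X) - (F Y + G Y)) \<le> C * norm (X - Y)"
    by blast
qed

lemma lipschitz_bounded_sum:
  assumes "finite A" "\<And>i. i \<in> A \<Longrightarrow> lipschitz_bounded (F i)"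
  shows "lipschitz_bounded (\<lambda>X. \<Sum>i\<in>A. F i X)"
  using assms
proof (induction A)
  case (insert i A)
  then have "lipschitz_bounded (\<lambda>X. F i X + (\<Sum>i\<in>A. F i X))"
    by (intro lipschitz_bounded_add) simp_all
  then show ?case using insert.hyps by simp
qed (simp add: lipschitz_bounded_const)

text \<open>The difference splits as b(FX - FY, GX) + b(FY, GX - GY); in each term one argument is
  bounded and the other is Lipschitz.\<close>

lemma lipschitz_bounded_bilinear:
  assumes b: "bounded_bilinear b" and F: "lipschitz_bounded F" and G: "lipschitz_bounded G"
  shows "lipschitz_bounded (\<lambda>X. b (F X) (G X))"
  unfolding lipschitz_bounded_def
proof
  fix K
  interpret bounded_bilinear b by fact
  obtain B where B: "0 \<le> B" "\<And>x y. norm (b x y) \<le> norm x * norm y * B"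
    using nonneg_bounded by blast
  obtain C where C: "0 \<le> C"
    "\<And>X Y. norm X \<le> K \<Longrightarrow> norm Y \<le> K \<Longrightarrow> norm (F X - F Y) \<le> C * norm (X - Y)"
    "\<And>X. norm X \<le> K \<Longrightarrow> norm (F X) \<le> C"
    using lipschitz_boundedE[OF F] by metis
  obtain D where D: "0 \<le> D"
    "\<And>X Y. norm X \<le> K \<Longrightarrow> norm Y \<le> K \<Longrightarrow> norm (G X - G Y) \<le> D * norm (X - Y)"
    "\<And>X. norm X \<le> K \<Longrightarrow> norm (G X) \<le> D"
    using lipschitz_boundedE[OF G] by metis
  have "norm (b (F X) (G X) - b (F Y) (G Y)) \<le> (2 * C * D * B) * norm (X - Y)"
    if XY: "norm X \<le> K" "norm Y \<le> K" for X Y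
  proof -
    have "b (F X) (G X) - b (F Y) (G Y) = b (F X - F Y) (G X) + b (F Y) (G X - G Y)"
      by (simp add: diff_left diff_right)
    then have "norm (b (F X) (G X) - b (F Y) (G Y))
        \<le> norm (F X - F Y) * norm (G X) * B + norm (F Y) * norm (G X - G Y) * B"
      using norm_triangle_ineq[of "b (F X - F Y) (G X)" "b (F Y) (G X - G Y)"]
        B(2)[of "F X - F Y" "G X"] B(2)[of "F Y" "G X - G Y"] by simp
    also have "\<dots> \<le> (C * norm (X - Y)) * D * B + C * (D * norm (X - Y)) * B"
      using B(1) C(1) D(1) C(2)[OF XY] D(2)[OF XY] C(3)[OF XY(2)] D(3)[OF XY(1)]
      by (intro add_mono mult_right_mono mult_mono) auto
    also have "\<dots> = (2 * C * D * B) * norm (X - Y)" by (simp add: algebra_simps)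
    finally show ?thesis .
  qed
  then show "\<exists>C. \<forall>X Y. norm X \<le> K \<longrightarrow> norm Y \<le> K \<longrightarrow>
      norm (b (F X) (G X) - b (F Y) (G Y)) \<le> C * norm (X - Y)"
    by blast
qed

lemma lipschitz_bounded_shifted_prod:
  "lipschitz_bounded (\<lambda>X :: 'n::finite sqmat. shifted_prod X cs)"
proof (induction cs)
  case Nil
  then show ?case by (simp add: lipschitz_bounded_const)
next
  case (Cons c cs)
  have "lipschitz_bounded (\<lambda>X :: 'n sqmat. X + - mat c)"
    by (intro lipschitz_bounded_add lipschitz_bounded_const
        lipschitz_bounded_linear[OF bounded_linear_ident])
  then show ?case
    using lipschitz_bounded_bilinear[OF bounded_bilinear_matrix_mult _ Cons.IH] by simp
qed

text \<open>Both solutions stay in the ball of radius \<open>K\<close>, so one constant controls the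
  derivative of the squared distance by that squared distance, and \<open>gronwall_zero\<close>
  applies.\<close>

lemma lipschitz_ode_unique:
  fixes S T :: "real \<Rightarrow> 'a::real_inner"
  assumes I: "is_interval I" "0 \<in> I" "t \<in> I" and F: "lipschitz_bounded F"
    and S: "\<And>s. s \<in> I \<Longrightarrow> (S has_vector_derivative F (S s)) (at s within I)"
    and T: "\<And>s. s \<in> I \<Longrightarrow> (T has_vector_derivative F (T s)) (at s within I)"
    and norm: "\<And>s. s \<in> I \<Longrightarrow> norm (S s) \<le> K" "\<And>s. s \<in> I \<Longrightarrow> norm (T s) \<le> K"
    and "S 0 = T 0"
  shows "S t = T t"
proof -
  obtain C where C: "\<And>X Y. norm X \<le> K \<Longrightarrow> norm Y \<le> K \<Longrightarrow> norm (F X - F Y) \<le> C * norm (X - Y)"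
    using lipschitz_boundedE[OF F] by metis
  let ?D = "\<lambda>s. S s - T s"
  have "?D t \<bullet> ?D t = 0"
  proof (rule gronwall_zero[OF I])
    fix s assume s: "s \<in> I"
    show "((\<lambda>s. ?D s \<bullet> ?D s) has_real_derivative 2 * (?D s \<bullet> (F (S s) - F (T s)))) (at s within I)"
      by (intro has_vector_derivative_inner_self has_vector_derivative_diff S T s)
    have "\<bar>?D s \<bullet> (F (S s) - F (T s))\<bar> \<le> norm (?D s) * norm (F (S s) - F (T s))"
      by (rule Cauchy_Schwarz_ineq2)
    also have "\<dots> \<le> norm (?D s) * (C * norm (?D s))"
      by (intro mult_left_mono C norm s) simp
    also have "\<dots> = C * (?D s \<bullet> ?D s)"
      by (simp add: power2_norm_eq_inner[symmetric] power2_eq_square)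
    finally show "\<bar>2 * (?D s \<bullet> (F (S s) - F (T s)))\<bar> \<le> (2 * C) * (?D s \<bullet> ?D s)" by simp
  qed (simp_all add: \<open>S 0 = T 0\<close>)
  then show ?thesis by simp
qed

text \<open>The Lagrange interpolation polynomial of \<open>f\<close> at the nodes
  \<open>d$i\<close>, evaluated at \<open>M\<close>. Sorting merely turns the set of the other nodes
  into a list.\<close>

definition lagrange_matrix :: "(real \<Rightarrow> real) \<Rightarrow> (real, 'n::finite) vec \<Rightarrow> 'n sqmat \<Rightarrow> 'n sqmat" where
  "lagrange_matrix f d M = (\<Sum>i\<in>UNIV.
     (f (d$i) / (\<Prod>c\<leftarrow>sorted_list_of_set (range (($) d) - {d$i}). d$i - c)) *\<^sub>R
       shifted_prod M (sorted_list_of_set (range (($) d) - {d$i})))"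

lemma lipschitz_bounded_lagrange_matrix: "lipschitz_bounded (lagrange_matrix f d)"
  unfolding lagrange_matrix_def[abs_def]
  by (intro lipschitz_bounded_sum lipschitz_bounded_shifted_prod
      lipschitz_bounded_compose_linear[OF bounded_linear_scaleR_right]) simp

lemma prod_list_diff_eq_0_iff: "(\<Prod>c\<leftarrow>cs. a - c) = 0 \<longleftrightarrow> a \<in> set cs" for a :: real
  by (induction cs) auto

text \<open>Each normalized basis polynomial is 1 at its own node and 0 at the others, so on the
  diagonal only the value of \<open>f\<close> at the matching node remains.\<close>

lemma lagrange_matrix_conj_diag:
  fixes U :: "'n::finite sqmat"
  assumes U: "orthogonal_matrix U" and inj: "inj (($) d)"
  shows "lagrange_matrix f d (U ** diag_matrix d ** transpose U)
    = U ** diag_matrix (\<chi> i. f (d$i)) ** transpose U"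
proof -
  let ?cs = "\<lambda>i. sorted_list_of_set (range (($) d) - {d$i})"
  let ?a = "\<lambda>i. f (d$i) / (\<Prod>c\<leftarrow>?cs i. d$i - c)"
  have lin: "bounded_linear (\<lambda>X. U ** X ** transpose U)"
    using bounded_linear_compose[OF
        bounded_bilinear.bounded_linear_left[OF bounded_bilinear_matrix_mult]
        bounded_bilinear.bounded_linear_right[OF bounded_bilinear_matrix_mult]] .
  have "(\<Sum>i\<in>UNIV. ?a i *\<^sub>R diag_matrix (\<chi> k. \<Prod>c\<leftarrow>?cs i. d$k - c))
    = diag_matrix (\<chi> k. f (d$k))"
  proof -
    have "?a i * (\<Prod>c\<leftarrow>?cs i. d$k - c) = (if i = k then f (d$k) else 0)" for i k
      using inj by (auto simp: prod_list_diff_eq_0_iff inj_eq)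
    then have "(\<Sum>i\<in>UNIV. ?a i * (\<Prod>c\<leftarrow>?cs i. d$k - c)) = f (d$k)" for k
      by simp
    then show ?thesis
      by (simp add: vec_eq_iff diag_matrix_def)
  qed
  moreover have "lagrange_matrix f d (U ** diag_matrix d ** transpose U)
    = U ** (\<Sum>i\<in>UNIV. ?a i *\<^sub>R diag_matrix (\<chi> k. \<Prod>c\<leftarrow>?cs i. d$k - c)) ** transpose U"
    by (simp only: lagrange_matrix_def shifted_prod_conj[OF U]
        linear_sum[OF bounded_linear.linear[OF lin]] linear_scale[OF bounded_linear.linear[OF lin]])
  ultimately show ?thesis by simp
qed

text \<open>Along a solution the eigenvalues are those in \<open>d\<close>, so
  \<open>matrix_ln\<close> may be replaced by interpolation. The resulting field \<open>?F\<close>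
  is defined on all matrices and Lipschitz on bounded sets.\<close>

lemma qr_flow_unique:
  fixes S T :: "real \<Rightarrow> 'n::{finite,linorder} sqmat"
  assumes U: "orthogonal_matrix U" and d: "inj (($) d)"
    and S0: "S0 = U ** diag_matrix d ** transpose U"
    and I: "is_interval I" "0 \<in> I" "t \<in> I"
    and S: "qr_flow_solution I S0 S" and T: "qr_flow_solution I S0 T"
  shows "S t = T t"
proof -
  let ?F = "\<lambda>X. mat_commutator X (skew_part (lagrange_matrix ln d X))"
  have F: "lipschitz_bounded ?F"
  proof -
    have A: "lipschitz_bounded (\<lambda>X. skew_part (lagrange_matrix ln d X))"
      by (rule lipschitz_bounded_compose_linear[OF bounded_linear_skew_part
            lipschitz_bounded_lagrange_matrix])
    note id = lipschitz_bounded_linear[OF bounded_linear_ident]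
    note mult = lipschitz_bounded_bilinear[OF bounded_bilinear_matrix_mult]
    have "lipschitz_bounded (\<lambda>X. X ** skew_part (lagrange_matrix ln d X)
        + - (skew_part (lagrange_matrix ln d X) ** X))"
      by (intro lipschitz_bounded_add mult id A
          lipschitz_bounded_compose_linear[OF bounded_linear_minus[OF bounded_linear_ident]])
    then show ?thesis by (simp add: mat_commutator_def)
  qed
  have eq: "matrix_ln (X s) = lagrange_matrix ln d (X s)"
    if X: "qr_flow_solution I S0 X" and s: "s \<in> I" for X s
  proof -
    have "d$i \<in> eigenvalues (X s)" for i
    proof (rule qr_flow_eigenvalue[OF I(1,2) s X])
      \<comment> \<open>The product over all eigenvalues has a zero factor at each
        \<open>d$k\<close>; with \<open>d$i\<close> left out of the list it is nonzero at
        \<open>d$i\<close>.\<close>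
      let ?cs = "sorted_list_of_set (range (($) d) - {d$i})"
      have zero: "diag_matrix (\<chi> k. \<Prod>c\<leftarrow>d$i # ?cs. d$k - c) = 0"
        by (auto simp: diag_matrix_def vec_eq_iff prod_list_diff_eq_0_iff)
      show "shifted_prod S0 (d$i # ?cs) = 0"
        unfolding S0 shifted_prod_conj[OF U] zero by simp
      have "diag_matrix (\<chi> k. \<Prod>c\<leftarrow>?cs. d$k - c) $ i $ i \<noteq> 0"
        by (simp add: diag_matrix_def prod_list_diff_eq_0_iff)
      then have nz: "diag_matrix (\<chi> k. \<Prod>c\<leftarrow>?cs. d$k - c) \<noteq> (0 :: 'n sqmat)"
        by (metis zero_index)
      show "shifted_prod S0 ?cs \<noteq> 0"
      proof
        assume zero: "shifted_prod S0 ?cs = 0"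
        have "diag_matrix (\<chi> k. \<Prod>c\<leftarrow>?cs. d$k - c) = transpose U ** (shifted_prod S0 ?cs ** U)"
          unfolding S0 shifted_prod_conj[OF U]
          by (simp add: orthogonal_matrix_transpose_mult[OF U] flip: matrix_mul_assoc)
        then show False using nz zero by simp
      qed
    qed
    moreover have "symmetric_matrix (X s)" using X s by (simp add: qr_flow_solution_def)
    ultimately obtain V where V: "orthogonal_matrix V" "X s = V ** diag_matrix d ** transpose V"
      using symmetric_diagonalization d by blast
    show ?thesis
      unfolding V(2) matrix_ln_def spectral_calculus_conj_diag[OF V(1)]
        lagrange_matrix_conj_diag[OF V(1) d] ..
  qed
  show ?thesis
  proof (rule lipschitz_ode_unique[OF I F])
    have deriv: "(X has_vector_derivative ?F (X s)) (at s within I)"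
      and norm: "norm (X s) \<le> norm S0"
      if X: "qr_flow_solution I S0 X" and s: "s \<in> I" for X s
    proof -
      show "(X has_vector_derivative ?F (X s)) (at s within I)"
        using X s unfolding eq[OF X s, symmetric] qr_flow_solution_def by blast
      \<comment> \<open>For the list \<open>[0]\<close> the product is the matrix itself.\<close>
      show "norm (X s) \<le> norm S0"
        using qr_flow_norm_shifted_prod[OF I(1,2) s X, of "[0]"] by simp
    qed
    show "(S has_vector_derivative ?F (S s)) (at s within I)"
      "(T has_vector_derivative ?F (T s)) (at s within I)"
      "norm (S s) \<le> norm S0" "norm (T s) \<le> norm S0" if "s \<in> I" for s
      using deriv norm S T that by blast+
    show "S 0 = T 0" using S T by (simp add: qr_flow_solution_def)
  qed
qed

lemma qr_flow_solution_subset: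
  assumes "qr_flow_solution J S0 S" "I \<subseteq> J"
  shows "qr_flow_solution I S0 S"
  using assms unfolding qr_flow_solution_def
  by (meson has_vector_derivative_within_subset subsetD)

text \<open>Speaking of the flow presupposes existence and uniqueness. Hence the global solution
  comes with a comparison to solutions on arbitrary intervals around or ending at 0.\<close>

theorem theorem5p1:
  fixes S0 :: "'n::{finite,linorder} sqmat"
  assumes "symmetric_matrix S0"
    and "positive_spectrum S0"
    and "simple_spectrum S0"
  shows "\<exists>S. qr_flow_solution UNIV S0 S \<and>
           (\<forall>I T. is_interval I \<and> 0 \<in> I \<and> qr_flow_solution I S0 T \<longrightarrow> (\<forall>t\<in>I. T t = S t)) \<and>
           (\<forall>m. S (real m) = qr_sequence S0 m)"
proof -
  have card: "card (eigenvalues S0) = card (UNIV :: 'n set)"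
    using assms(3) by (simp add: simple_spectrum_def)
  \<comment> \<open>An infinite set would have \<open>card\<close> equal to 0, whereas the index
    type is nonempty.\<close>
  then have "finite (eigenvalues S0)"
    by (metis card.infinite finite_UNIV_card_ge_0 finite_class.finite_UNIV less_irrefl)
  \<comment> \<open>Simplicity gives as many eigenvalues as indices, so they can be enumerated by
    the index type without repetition.\<close>
  then obtain e where e: "bij_betw e (UNIV :: 'n set) (eigenvalues S0)"
    using finite_same_card_bij[OF finite_class.finite_UNIV _ card[symmetric]] by blast
  define d :: "(real, 'n) vec" where "d = (\<chi> i. e i)"
  have inj: "inj (($) d)" using e by (simp add: d_def bij_betw_def inj_on_def)
  have ev: "d$i \<in> eigenvalues S0" for i
    using e by (auto simp: d_def bij_betw_def)
  obtain U where U: "orthogonal_matrix U" and S0: "S0 = U ** diag_matrix d ** transpose U"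
    using symmetric_diagonalization[OF assms(1) inj ev] by blast
  have pos: "0 < d$i" for i
    using ev assms(2) by (simp add: positive_spectrum_def)
  \<comment> \<open>Positivity allows the logarithms of \<open>d\<close> to serve as
    \<open>c\<close> in \<open>qr_flow_interpolates\<close>.\<close>
  have exp_ln: "(\<chi> i. exp ((\<chi> i. ln (d$i)) $ i)) = d"
    by (simp add: vec_eq_iff pos)
  obtain S where S: "qr_flow_solution UNIV S0 S" "\<And>m. S (real m) = qr_sequence S0 m"
    using qr_flow_interpolates[OF U, of "\<chi> i. ln (d$i)"] unfolding exp_ln S0[symmetric] by blast
  have "T t = S t" if "is_interval I" "0 \<in> I" "qr_flow_solution I S0 T" "t \<in> I" for I T t
    using qr_flow_unique[OF U inj S0 that(1,2,4,3)] qr_flow_solution_subset[OF S(1)] by blast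
  then show ?thesis using S by blast
qed

end
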